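(* There exists a constant $c \ge 25$ such that for every integer $k$ with $5 \le k \le c$ and all integers $p \ge k+2$ and $q \ge k+2$, $$r_k(p,q) \ge (p-1)\cdot\bigl(r_k(p-1,q)-1\bigr)+1.$$
   Context: For integers $k,p,q$, the Ramsey number $r_k(p,q)$ is the smallest integer $N$ such that for every coloring of all $k$-element subsets of $\{1,\dots,N\}$ with the colors red and blue, there exist either $p$ elements of $\{1,\dots,N\}$ all of whose $k$-element subsets are red, or $q$ elements of $\{1,\dots,N\}$ all of whose $k$-element subsets are blue. *)

theory Defs
  imports "HOL-Library.Ramsey"
begin

text \<open>In \<open>partn_lst {1..N} [p, q] k\<close> the \<open>k\<close>-element subsets of \<open>{1..N}\<close> are
  coloured with 0 (red, paired with \<open>p\<close>) and 1 (blue, paired with \<open>q\<close>), and a set of \<open>p\<close> elements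
  all of whose \<open>k\<close>-subsets have colour 0, or of \<open>q\<close> elements all of whose \<open>k\<close>-subsets have
  colour 1, is required.\<close>

definition ramsey_number :: "nat \<Rightarrow> nat \<Rightarrow> nat \<Rightarrow> nat"
  where "ramsey_number k p q = (LEAST N. partn_lst {1..N} [p, q] k)"

text \<open>The least element exists, so the definition is meaningful for all arguments.\<close>

lemma partn_lst_ramsey_number: "partn_lst {1..ramsey_number k p q} [p, q] k"
proof -
  obtain N :: nat where N: "partn_lst {..<N} [p, q] k"
    using ramsey_full by blast
  have img: "Suc ` X \<in> nsets {1..N} m" if "X \<in> nsets {..<N} m" for X m
    using that by (fastforce simp: nsets_def card_image)
  have "partn_lst {1..N} [p, q] k"
    unfolding partn_lst_def monochromatic_def
  proof
    fix f assume f: "f \<in> nsets {1..N} k \<rightarrow> {..<length [p, q]}"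
    have "(\<lambda>X. f (Suc ` X)) \<in> nsets {..<N} k \<rightarrow> {..<length [p, q]}"
      using f img by blast
    then obtain i H where i: "i < length [p, q]" and H: "H \<in> nsets {..<N} ([p, q] ! i)"
      and mono: "(\<lambda>X. f (Suc ` X)) ` nsets H k \<subseteq> {i}"
      using N by (elim partn_lstE) auto
    have "f ` nsets (Suc ` H) k \<subseteq> {i}"
    proof clarify
      fix Y assume "Y \<in> nsets (Suc ` H) k"
      then obtain X where "X \<subseteq> H" "Y = Suc ` X" "finite Y" "card Y = k"
        by (auto simp: nsets_def subset_image_iff)
      then have "X \<in> nsets H k" and "Y = Suc ` X"
        by (auto simp: nsets_def card_image finite_image_iff)
      then show "f Y = i"
        using mono by blast
    qed
    then show "\<exists>i<length [p, q]. \<exists>H\<in>nsets {1..N} ([p, q] ! i). f ` nsets H k \<subseteq> {i}"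
      using i img[OF H] by blast
  qed
  then show ?thesis
    unfolding ramsey_number_def by (rule LeastI)
qed

end

theory Submission
  imports Defs
begin

text \<open>
  Let \<open>n = r\<^sub>k(p - 1, q) - 1\<close> and take a colouring of the \<open>k\<close>-subsets of an \<open>n\<close>-set that has
  neither a red \<open>(p - 1)\<close>-set nor a blue \<open>q\<close>-set. Arrange \<open>(p - 1) * n\<close> points in \<open>p - 1\<close> blocks of
  size \<open>n\<close>. A \<open>k\<close>-set inside one block gets its colour from the given colouring. Any other \<open>k\<close>-set
  \<open>X\<close> gets a colour that depends only on its type, the function \<open>a\<close> that sends a block to the number
  of points of \<open>X\<close> in it. Let \<open>m\<close> be the number of blocks that \<open>X\<close> meets and \<open>d\<close> the number of
  blocks that it meets in an odd number of points. The type is red in exactly these cases: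

  \<^item> \<open>m \<le> 2\<close> and \<open>k\<close> minus the largest entry of \<open>a\<close> is odd;
  \<^item> \<open>m = k\<close>;
  \<^item> \<open>3 \<le> m \<le> k - 2\<close> and \<open>d\<close> is \<open>0\<close> or \<open>1\<close> modulo \<open>4\<close>.

  In particular \<open>(k - 1, 1)\<close> and \<open>(1, \<dots>, 1)\<close> are red, while \<open>(k - 2, 2)\<close>, \<open>(k - 2, 1, 1)\<close> and
  \<open>(2, 1, \<dots>, 1)\<close> are blue.

  The heart of the matter is \<open>splits_both_of_le\<close>: every type of a \<open>(k + 2)\<close>-set with all entries at
  most \<open>k - 2\<close>, and not all at most \<open>1\<close>, dominates (entrywise) both a red and a blue type of a
  \<open>k\<close>-set. Taking \<open>2\<close> from one entry does not change \<open>d\<close>, whereas taking \<open>1\<close> from each of two entries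
  of equal parity changes \<open>d\<close> by \<open>2\<close> and so flips the colour, provided that the number of positive
  entries stays between \<open>3\<close> and \<open>k - 2\<close>. Among three positive entries two have equal parity. The
  special rule for \<open>m \<le> 2\<close> handles two positive entries, where such a pair need not exist, and three
  positive entries \<open>1\<close>, odd and even, where the pair can only be lowered by emptying a block. The
  special rules for \<open>m \<ge> k - 1\<close> handle the types that are close to \<open>(1, \<dots>, 1)\<close>.

  Now let \<open>H\<close> be a monochromatic set with at least \<open>k + 2\<close> points. If it meets every block in at most
  \<open>k - 2\<close> points, then it meets every block at most once; so it has at most \<open>p - 1\<close> points, and it is red
  since \<open>(1, \<dots>, 1)\<close> is. If it meets a block in at least \<open>k - 1\<close> points and is not contained in it,
  then it has an edge of type \<open>(k - 1, 1)\<close> and is red; two points outside the block would give a blue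
  edge, hence all points but one lie in the block. As a block contains no red \<open>(p - 1)\<close>-set and no
  blue \<open>q\<close>-set, \<open>H\<close> is neither a red \<open>p\<close>-set nor a blue \<open>q\<close>-set.
\<close>

section \<open>Types and their colours\<close>

text \<open>A type is a function on the finite set \<open>I\<close> of blocks. Its parts are its positive entries.\<close>

definition nparts :: "'i set \<Rightarrow> ('i \<Rightarrow> nat) \<Rightarrow> nat"
  where "nparts I a = card {i \<in> I. 0 < a i}"

text \<open>The number of odd entries.\<close>

definition nodd :: "'i set \<Rightarrow> ('i \<Rightarrow> nat) \<Rightarrow> nat"
  where "nodd I a = card {i \<in> I. odd (a i)}"

text \<open>The colour of a type. Here \<open>k\<close> is the sum of the entries, and the \<open>i\<close> of the first case is a
  block with the largest entry.\<close>

definition red_type :: "'i set \<Rightarrow> ('i \<Rightarrow> nat) \<Rightarrow> bool"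
  where "red_type I a =
    (let k = sum a I; m = nparts I a in
      if m \<le> 2 then \<exists>i\<in>I. odd (k - a i) \<and> (\<forall>j\<in>I. a j \<le> a i)
      else if m = k then True
      else if m = k - 1 then False
      else nodd I a mod 4 < 2)"

lemma nparts_eq_sum: "finite I \<Longrightarrow> nparts I a = (\<Sum>i\<in>I. min 1 (a i))"
proof -
  assume "finite I"
  then have "nparts I a = (\<Sum>i\<in>I. if 0 < a i then 1 else 0)"
    by (simp add: nparts_def sum.If_cases Collect_conj_eq Int_commute)
  also have "\<dots> = (\<Sum>i\<in>I. min 1 (a i))"
    by (rule sum.cong) auto
  finally show ?thesis .
qed

lemma nodd_eq_sum: "finite I \<Longrightarrow> nodd I a = (\<Sum>i\<in>I. a i mod 2)"
proof -
  assume "finite I"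
  then have "nodd I a = (\<Sum>i\<in>I. if odd (a i) then 1 else 0)"
    by (simp add: nodd_def sum.If_cases Collect_conj_eq Int_commute Compl_eq)
  also have "\<dots> = (\<Sum>i\<in>I. a i mod 2)"
    by (rule sum.cong) (auto simp: odd_iff_mod_2_eq_one)
  finally show ?thesis .
qed

lemma sum_comp_fun_upd:
  fixes g :: "nat \<Rightarrow> nat"
  assumes "finite I" "i \<in> I"
  shows "(\<Sum>l\<in>I. g ((a(i := v)) l)) + g (a i) = (\<Sum>l\<in>I. g (a l)) + g v"
proof -
  have "(\<Sum>l\<in>I - {i}. g ((a(i := v)) l)) = (\<Sum>l\<in>I - {i}. g (a l))"
    by (rule sum.cong) auto
  then show ?thesis
    using assms by (simp add: sum.remove[of I i])
qed

lemma fun_upd_stats: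
  fixes a :: "'i \<Rightarrow> nat"
  assumes "finite I" "i \<in> I"
  shows "sum (a(i := v)) I + a i = sum a I + v"
    and "nparts I (a(i := v)) + min 1 (a i) = nparts I a + min 1 v"
    and "nodd I (a(i := v)) + a i mod 2 = nodd I a + v mod 2"
  using sum_comp_fun_upd[OF assms, of "\<lambda>n. n" a v] sum_comp_fun_upd[OF assms, of "\<lambda>n. min 1 n" a v]
    sum_comp_fun_upd[OF assms, of "\<lambda>n. n mod 2" a v] \<open>finite I\<close>
  by (simp_all only: nparts_eq_sum nodd_eq_sum)

text \<open>The two ways to remove two points: both from block \<open>i\<close>, or one from each of the blocks
  \<open>i \<noteq> j\<close>.\<close>

definition drop_two :: "('i \<Rightarrow> nat) \<Rightarrow> 'i \<Rightarrow> 'i \<Rightarrow> nat"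
  where "drop_two a i = a(i := a i - 2)"

definition drop_pair :: "('i \<Rightarrow> nat) \<Rightarrow> 'i \<Rightarrow> 'i \<Rightarrow> 'i \<Rightarrow> nat"
  where "drop_pair a i j = a(i := a i - 1, j := a j - 1)"

lemma drop_two_le: "drop_two a i \<le> a"
  by (auto simp: drop_two_def le_fun_def)

lemma drop_pair_le: "drop_pair a i j \<le> a"
  by (auto simp: drop_pair_def le_fun_def)

lemma drop_two_stats:
  assumes "finite I" "i \<in> I" "2 \<le> a i"
  shows "sum (drop_two a i) I + 2 = sum a I"
    and "nparts I (drop_two a i) + (if a i = 2 then 1 else 0) = nparts I a"
    and "nodd I (drop_two a i) = nodd I a"
proof -
  have "(a i - 2) mod 2 = a i mod 2"
    using le_mod_geq[OF assms(3)] by simp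
  note upd = fun_upd_stats[OF assms(1,2), of a "a i - 2", folded drop_two_def, unfolded this]
  show "sum (drop_two a i) I + 2 = sum a I"
    using upd(1) assms(3) by linarith
  show "nparts I (drop_two a i) + (if a i = 2 then 1 else 0) = nparts I a"
    using upd(2) assms(3) by (auto simp: min_def split: if_splits)
  show "nodd I (drop_two a i) = nodd I a"
    using upd(3) by simp
qed

lemma drop_pair_stats:
  assumes "finite I" "i \<in> I" "j \<in> I" "i \<noteq> j" "0 < a i" "0 < a j"
  shows "sum (drop_pair a i j) I + 2 = sum a I"
    and "nparts I (drop_pair a i j) + (if a i = 1 then 1 else 0) + (if a j = 1 then 1 else 0)
           = nparts I a"
    and "nodd I (drop_pair a i j) + 2 * (a i mod 2) + 2 * (a j mod 2) = nodd I a + 2"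
proof -
  let ?b = "a(i := a i - 1)"
  have m: "(a i - 1) mod 2 = 1 - a i mod 2" "(a j - 1) mod 2 = 1 - a j mod 2"
    using assms(5,6) by (auto simp: mod2_eq_if)
  have bj: "?b j = a j"
    using assms(4) by simp
  note 1 = fun_upd_stats[OF assms(1,2), of a "a i - 1"]
  note 2 = fun_upd_stats[OF assms(1,3), of ?b "a j - 1", unfolded bj]
  show "sum (drop_pair a i j) I + 2 = sum a I"
    using 1(1) 2(1) assms(5,6) unfolding drop_pair_def by linarith
  show "nparts I (drop_pair a i j) + (if a i = 1 then 1 else 0) + (if a j = 1 then 1 else 0)
           = nparts I a"
    using 1(2) 2(2) assms(5,6) by (auto simp: drop_pair_def min_def split: if_splits)
  show "nodd I (drop_pair a i j) + 2 * (a i mod 2) + 2 * (a j mod 2) = nodd I a + 2"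
    using 1(3) 2(3) mod_less_divisor[of 2 "a i"] mod_less_divisor[of 2 "a j"]
    unfolding drop_pair_def m by linarith
qed

lemma sum_eq_sum_parts:
  fixes a :: "'i \<Rightarrow> nat"
  assumes "finite I"
  shows "sum a I = sum a {i \<in> I. 0 < a i}"
  using assms by (intro sum.mono_neutral_right) auto

lemma nparts_le_sum: "finite I \<Longrightarrow> nparts I a \<le> sum a I"
  by (simp add: nparts_eq_sum sum_mono)

lemma nodd_parity: "finite I \<Longrightarrow> even (sum a I + nodd I a)"
proof -
  assume "finite I"
  then have "even (\<Sum>i\<in>I. a i + a i mod 2)"
    by (intro dvd_sum) (simp add: mod2_eq_if)
  then show ?thesis
    using \<open>finite I\<close> by (simp add: nodd_eq_sum sum.distrib)
qed

text \<open>A type whose sum is less than twice its number of parts has entries equal to \<open>1\<close>.\<close>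

lemma two_nparts_le:
  assumes "finite I"
  shows "2 * nparts I a \<le> sum a I + card {i \<in> I. a i = 1}"
proof -
  have "card {i \<in> I. a i = 1} = (\<Sum>i\<in>I. if a i = 1 then 1 else 0)"
    using assms by (simp add: sum.If_cases Collect_conj_eq Int_commute)
  then have "sum a I + card {i \<in> I. a i = 1} = (\<Sum>i\<in>I. a i + (if a i = 1 then 1 else 0))"
    by (simp add: sum.distrib)
  moreover have "2 * nparts I a = (\<Sum>i\<in>I. 2 * min 1 (a i))"
    using assms by (simp add: nparts_eq_sum sum_distrib_left)
  moreover have "(\<Sum>i\<in>I. 2 * min 1 (a i)) \<le> (\<Sum>i\<in>I. a i + (if a i = 1 then 1 else 0))"
    by (rule sum_mono) auto
  ultimately show ?thesis by simp
qed

text \<open>If the sum exceeds the number of parts by two, then two points can be removed without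
  emptying a block.\<close>

lemma drop_excess:
  assumes "finite I" "nparts I a + 2 \<le> sum a I"
  shows "\<exists>b\<le>a. sum b I + 2 = sum a I \<and> nparts I b = nparts I a"
proof (cases "\<exists>i\<in>I. 3 \<le> a i")
  case True
  then obtain i where i: "i \<in> I" "3 \<le> a i" by blast
  then show ?thesis
    using drop_two_stats[of I i a] assms(1) drop_two_le[of a i]
    by (intro exI[of _ "drop_two a i"]) auto
next
  case False
  have "\<exists>i\<in>I. 2 \<le> a i"
  proof (rule ccontr)
    assume "\<not> ?thesis"
    then have "sum a I \<le> (\<Sum>i\<in>I. min 1 (a i))"
      by (intro sum_mono) force
    then show False
      using assms by (simp add: nparts_eq_sum)
  qed
  then obtain i where i: "i \<in> I" "a i = 2"
    using False by force
  have "\<exists>j\<in>I. j \<noteq> i \<and> 2 \<le> a j"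
  proof (rule ccontr)
    assume "\<not> ?thesis"
    then have "sum a (I - {i}) \<le> (\<Sum>j\<in>I - {i}. min 1 (a j))"
      by (intro sum_mono) force
    then show False
      using assms i by (simp add: nparts_eq_sum sum.remove[of I i])
  qed
  then obtain j where j: "j \<in> I" "j \<noteq> i" "2 \<le> a j" by blast
  then show ?thesis
    using drop_pair_stats[of I i j a] assms(1) drop_pair_le[of a i j] i
    by (intro exI[of _ "drop_pair a i j"]) auto
qed

lemma red_type_few_parts:
  assumes "nparts I a \<le> 2" "i \<in> I" "\<And>j. j \<in> I \<Longrightarrow> a j \<le> a i"
  shows "red_type I a \<longleftrightarrow> odd (sum a I - a i)"
proof -
  have "(\<exists>j\<in>I. odd (sum a I - a j) \<and> (\<forall>l\<in>I. a l \<le> a j)) \<longleftrightarrow> odd (sum a I - a i)"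
  proof
    assume "\<exists>j\<in>I. odd (sum a I - a j) \<and> (\<forall>l\<in>I. a l \<le> a j)"
    then obtain j where j: "j \<in> I" "odd (sum a I - a j)" "\<forall>l\<in>I. a l \<le> a j"
      by blast
    have "a j = a i"
      by (rule order_antisym[OF assms(3)[OF j(1)] j(3)[rule_format, OF assms(2)]])
    then show "odd (sum a I - a i)"
      using j(2) by simp
  qed (use assms(2,3) in blast)
  then show ?thesis
    unfolding red_type_def Let_def if_P[OF assms(1)] .
qed

lemma red_type_all_parts: "3 \<le> nparts I a \<Longrightarrow> nparts I a = sum a I \<Longrightarrow> red_type I a"
  by (simp add: red_type_def)

lemma not_red_type_pred_parts: "3 \<le> nparts I a \<Longrightarrow> nparts I a = sum a I - 1 \<Longrightarrow> \<not> red_type I a"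
  by (auto simp: red_type_def)

lemma red_type_middle:
  "3 \<le> nparts I a \<Longrightarrow> nparts I a + 2 \<le> sum a I \<Longrightarrow> red_type I a \<longleftrightarrow> nodd I a mod 4 < 2"
  by (auto simp: red_type_def)

section \<open>Types that dominate both colours\<close>

text \<open>A set of type \<open>a\<close> contains \<open>k\<close>-subsets of red type and \<open>k\<close>-subsets of blue type.\<close>

definition splits_both :: "'i set \<Rightarrow> nat \<Rightarrow> ('i \<Rightarrow> nat) \<Rightarrow> bool"
  where "splits_both I k a \<longleftrightarrow>
    (\<exists>b c. b \<le> a \<and> c \<le> a \<and> sum b I = k \<and> sum c I = k \<and> red_type I b \<and> \<not> red_type I c)"

lemma splits_bothI:
  assumes "b \<le> a" "c \<le> a" "sum b I = k" "sum c I = k" "red_type I b \<noteq> red_type I c"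
  shows "splits_both I k a"
proof (cases "red_type I b")
  case True
  then show ?thesis
    using assms unfolding splits_both_def by (intro exI[of _ b] exI[of _ c]) (intro conjI; simp)
next
  case False
  then show ?thesis
    using assms unfolding splits_both_def by (intro exI[of _ c] exI[of _ b]) (intro conjI; simp)
qed

text \<open>The main source of two colours: in the range where the number of odd entries decides, a change
  of this number by two flips the colour.\<close>

lemma splits_both_middle:
  assumes "b \<le> a" "c \<le> a" "sum b I = k" "sum c I = k"
    and "3 \<le> nparts I b" "nparts I b + 2 \<le> k" "3 \<le> nparts I c" "nparts I c + 2 \<le> k"
    and "nodd I b = nodd I c + 2 \<or> nodd I c = nodd I b + 2"
  shows "splits_both I k a"
proof (rule splits_bothI[OF assms(1-4)])
  have *: "n mod 4 < 2 \<longleftrightarrow> \<not> m mod 4 < 2" if "n = m + 2 \<or> m = n + 2" for m n :: nat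
    using that by (auto simp: mod_add_eq; presburger)
  have "red_type I b \<longleftrightarrow> nodd I b mod 4 < 2"
    by (rule red_type_middle) (use assms(3,5,6) in simp_all)
  moreover have "red_type I c \<longleftrightarrow> nodd I c mod 4 < 2"
    by (rule red_type_middle) (use assms(4,7,8) in simp_all)
  ultimately show "red_type I b \<noteq> red_type I c"
    using *[OF assms(9)] by simp
qed

text \<open>For two parts, lowering the smaller entry by two keeps the largest entry, and lowering both by
  one lowers the largest entry by one.\<close>

lemma splits_both_two_parts:
  assumes fin: "finite I" and m: "nparts I a = 2" and sum: "sum a I = k + 2"
    and le: "\<And>i. i \<in> I \<Longrightarrow> a i \<le> k - 2" and k: "2 \<le> k"
  shows "splits_both I k a"
proof -
  obtain i j where P: "{i \<in> I. 0 < a i} = {i, j}" and "i \<noteq> j" and ji: "a j \<le> a i"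
  proof -
    obtain u v where "{i \<in> I. 0 < a i} = {u, v}" "u \<noteq> v"
      using m unfolding nparts_def card_2_iff by blast
    then show thesis
      using that[of u v] that[of v u] by (cases "a v \<le> a u") (auto simp: insert_commute)
  qed
  have mem: "x \<in> I \<and> 0 < a x \<longleftrightarrow> x = i \<or> x = j" for x
    using eqset_imp_iff[OF P, of x] by simp
  have I: "i \<in> I" "j \<in> I"
    using mem by blast+
  have out: "a l = 0" if "l \<in> I" "l \<noteq> i" "l \<noteq> j" for l
    using that mem[of l] by simp
  have s2: "a i + a j = k + 2"
    using sum sum_eq_sum_parts[OF fin, of a] \<open>i \<noteq> j\<close> unfolding P by simp
  have ge: "4 \<le> a i" "4 \<le> a j"
    using s2 le[OF I(1)] le[OF I(2)] k by linarith+
  let ?b = "drop_two a j" and ?c = "drop_pair a i j"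
  have sb: "sum ?b I = k" "nparts I ?b = 2"
    using drop_two_stats[where a = a, OF fin I(2)] ge sum m by auto
  have sc: "sum ?c I = k" "nparts I ?c = 2"
    using drop_pair_stats[where a = a, OF fin I \<open>i \<noteq> j\<close>] ge sum m by auto
  have b: "?b i = a i" "?b l \<le> a i" if "l \<in> I" for l
    using that out[of l] ji \<open>i \<noteq> j\<close> by (cases "l = i"; auto simp: drop_two_def)+
  have c: "?c i = a i - 1" "?c l \<le> a i - 1" if "l \<in> I" for l
    using that out[of l] ji \<open>i \<noteq> j\<close> by (cases "l = i"; auto simp: drop_pair_def)+
  have "red_type I ?b \<longleftrightarrow> odd (sum ?b I - ?b i)"
    by (rule red_type_few_parts[OF _ I(1)]) (use sb b I in auto)
  then have rb: "red_type I ?b \<longleftrightarrow> odd (k - a i)"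
    unfolding sb(1) b(1)[OF I(1)] .
  have "red_type I ?c \<longleftrightarrow> odd (sum ?c I - ?c i)"
    by (rule red_type_few_parts[OF _ I(1)]) (use sc c I in auto)
  then have rc: "red_type I ?c \<longleftrightarrow> odd (k - (a i - 1))"
    unfolding sc(1) c(1)[OF I(1)] .
  have "k - (a i - 1) = Suc (k - a i)"
    using le[OF I(1)] ge k by linarith
  then have "odd (k - (a i - 1)) \<longleftrightarrow> \<not> odd (k - a i)"
    by (simp only: even_Suc)
  then have "red_type I ?b \<noteq> red_type I ?c"
    using rb rc by blast
  then show ?thesis
    using splits_bothI[OF drop_two_le drop_pair_le sb(1) sc(1)] by blast
qed

text \<open>Removing two points from block \<open>i\<close> keeps the number of odd entries, and removing one point from
  each of the blocks \<open>u\<close> and \<open>v\<close>, whose entries have equal parity, changes it by two.\<close>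

lemma splits_both_keep_flip:
  assumes fin: "finite I" and sum: "sum a I = k + 2" and m: "nparts I a + 2 \<le> k"
    and i: "i \<in> I" "2 \<le> a i" "3 \<le> nparts I (drop_two a i)"
    and uv: "u \<in> I" "v \<in> I" "u \<noteq> v" "0 < a u" "0 < a v" "even (a u) \<longleftrightarrow> even (a v)"
      "3 \<le> nparts I (drop_pair a u v)"
  shows "splits_both I k a"
proof (rule splits_both_middle[OF drop_two_le drop_pair_le])
  note b = drop_two_stats[where a = a, OF fin i(1,2)] and c = drop_pair_stats[where a = a, OF fin uv(1-5)]
  show "sum (drop_two a i) I = k" "sum (drop_pair a u v) I = k"
    using b(1) c(1) sum by auto
  show "nparts I (drop_two a i) + 2 \<le> k" "nparts I (drop_pair a u v) + 2 \<le> k"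
    using b(2) c(2) m by linarith+
  show "nodd I (drop_two a i) = nodd I (drop_pair a u v) + 2 \<or>
      nodd I (drop_pair a u v) = nodd I (drop_two a i) + 2"
    using b(3) c(3) uv(6) by (auto simp: mod2_eq_if)
qed (use i uv in auto)

text \<open>Three parts \<open>1\<close>, odd and even are the one exception to the parity argument: every way to reach
  three parts leaves two odd entries, hence a blue type. A red one has two parts: \<open>k\<close> is even, and
  emptying the block with one point and lowering the even entry leaves two odd entries.\<close>

lemma splits_both_one_odd_even:
  assumes fin: "finite I" and sum: "sum a I = k + 2" and k: "5 \<le> k"
    and P: "{i \<in> I. 0 < a i} = {i, j, l}" and ne: "i \<noteq> j" "i \<noteq> l" "j \<noteq> l"
    and a: "a l = 1" "odd (a i)" "3 \<le> a i" "even (a j)"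
  shows "splits_both I k a"
proof -
  have mem: "x \<in> I \<and> 0 < a x \<longleftrightarrow> x = i \<or> x = j \<or> x = l" for x
    using eqset_imp_iff[OF P, of x] by simp
  have I: "i \<in> I" "j \<in> I" "l \<in> I" and pos: "0 < a j"
    using mem by blast+
  have s3: "a i + a j + 1 = k + 2"
    using sum sum_eq_sum_parts[OF fin, of a] ne a unfolding P by simp
  have m: "nparts I a = 3"
    using ne unfolding nparts_def P by simp
  have out: "a x = 0" if "x \<in> I" "x \<noteq> i" "x \<noteq> j" "x \<noteq> l" for x
    using that mem[of x] by simp
  have "x \<in> I \<and> odd (a x) \<longleftrightarrow> x = i \<or> x = l" for x
    using I a out[of x] by (cases "x = i \<or> x = j \<or> x = l") auto
  then have "{x \<in> I. odd (a x)} = {i, l}"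
    by blast
  then have o: "nodd I a = 2"
    using ne unfolding nodd_def by simp
  let ?b = "drop_pair a j l" and ?c = "drop_two a i"
  have j2: "2 \<le> a j"
    using pos a by (cases "a j") (auto elim: oddE)
  have sb: "sum ?b I = k" "nparts I ?b = 2"
    using drop_pair_stats[where a = a, OF fin I(2,3) ne(3)] sum m a j2 by auto
  have sc: "sum ?c I = k" "nparts I ?c = 3" "nodd I ?c = 2"
    using drop_two_stats[where a = a, OF fin I(1)] a(3) sum m o by auto
  have b: "?b i = a i" "?b j = a j - 1" "?b l = 0"
    using ne a by (auto simp: drop_pair_def)
  have bout: "?b x = 0" if "x \<in> I" "x \<noteq> i" "x \<noteq> j" for x
    using that b(3) out[of x] by (cases "x = l") (auto simp: drop_pair_def)
  have "red_type I ?b"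
  proof (cases "a j - 1 \<le> a i")
    case True
    have "red_type I ?b \<longleftrightarrow> odd (sum ?b I - ?b i)"
    proof (rule red_type_few_parts[OF _ I(1)])
      show "?b x \<le> ?b i" if "x \<in> I" for x
        using bout[OF that] b True by (cases "x = i"; cases "x = j") auto
    qed (use sb in simp)
    moreover have "sum ?b I - ?b i = a j - 1"
      using s3 pos sb(1) b(1) by linarith
    then have "odd (sum ?b I - ?b i)"
      using a(4) pos by (simp only: even_diff_nat) simp
    ultimately show ?thesis
      by blast
  next
    case False
    have "red_type I ?b \<longleftrightarrow> odd (sum ?b I - ?b j)"
    proof (rule red_type_few_parts[OF _ I(2)])
      show "?b x \<le> ?b j" if "x \<in> I" for x
        using bout[OF that] b False by (cases "x = i"; cases "x = j") auto
    qed (use sb in simp)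
    moreover have "sum ?b I - ?b j = a i"
      using s3 pos sb(1) b(2) by linarith
    then have "odd (sum ?b I - ?b j)"
      using a(2) by (simp only: not_False_eq_True)
    ultimately show ?thesis
      by blast
  qed
  moreover have "\<not> red_type I ?c"
    using red_type_middle[of I ?c] sc k by simp
  ultimately show ?thesis
    using splits_bothI[OF drop_pair_le drop_two_le sb(1) sc(1)] by blast
qed

lemma splits_both_three_parts:
  assumes fin: "finite I" and m: "nparts I a = 3" and sum: "sum a I = k + 2"
    and le: "\<And>i. i \<in> I \<Longrightarrow> a i \<le> k - 2" and k: "5 \<le> k"
  shows "splits_both I k a"
proof -
  obtain i j l where P: "{i \<in> I. 0 < a i} = {i, j, l}" and ne: "i \<noteq> j" "i \<noteq> l" "j \<noteq> l"
    using m unfolding nparts_def card_3_iff by blast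
  have mem: "x \<in> I \<and> 0 < a x \<longleftrightarrow> x = i \<or> x = j \<or> x = l" for x
    using eqset_imp_iff[OF P, of x] by simp
  have I: "i \<in> I" "j \<in> I" "l \<in> I" and pos: "0 < a i" "0 < a j" "0 < a l"
    using mem by blast+
  have s3: "a i + a j + a l = k + 2"
    using sum sum_eq_sum_parts[OF fin, of a] ne unfolding P by simp
  have flip: ?thesis
    if uv: "u \<in> I" "v \<in> I" "u \<noteq> v" "2 \<le> a u" "2 \<le> a v" "even (a u) \<longleftrightarrow> even (a v)" for u v
  proof -
    obtain x where x: "x \<in> I" "3 \<le> a x"
    proof -
      have "3 \<le> a i \<or> 3 \<le> a j \<or> 3 \<le> a l"
        using s3 k by linarith
      then show thesis
        using that I by blast
    qed
    show ?thesis
    proof (rule splits_both_keep_flip[OF fin sum, of x u v])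
      show "3 \<le> nparts I (drop_two a x)"
        using drop_two_stats(2)[where a = a, OF fin x(1)] x(2) m by auto
      show "3 \<le> nparts I (drop_pair a u v)"
        using drop_pair_stats(2)[where a = a, OF fin uv(1-3)] uv(4,5) m by auto
    qed (use m k x uv in auto)
  qed
  have one: ?thesis
    if "{i \<in> I. 0 < a i} = {u, v, w}" "u \<noteq> v" "u \<noteq> w" "v \<noteq> w" "a w = 1" "a u + a v + a w = k + 2"
    for u v w
  proof -
    have uvI: "u \<in> I" "v \<in> I"
      using that(1) by blast+
    have ge: "3 \<le> a u" "3 \<le> a v"
      using that(5,6) le[OF uvI(1)] le[OF uvI(2)] k by linarith+
    consider "even (a u) \<longleftrightarrow> even (a v)" | "odd (a u)" "even (a v)" | "odd (a v)" "even (a u)"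
      by blast
    then show ?thesis
    proof cases
      case 1
      then show ?thesis
        using flip[of u v] uvI ge that by auto
    next
      case 2
      show ?thesis
        using splits_both_one_odd_even[OF fin sum k that(1)] that ge 2 by auto
    next
      case 3
      have "{i \<in> I. 0 < a i} = {v, u, w}"
        unfolding that(1) by blast
      then show ?thesis
        using splits_both_one_odd_even[OF fin sum k, of v u w] that ge 3 by auto
    qed
  qed
  consider "a i = 1" | "a j = 1" | "a l = 1" | "2 \<le> a i" "2 \<le> a j" "2 \<le> a l"
    using pos by linarith
  then show ?thesis
  proof cases
    case 1
    have "{i \<in> I. 0 < a i} = {j, l, i}"
      unfolding P by blast
    then show ?thesis
      using one[of j l i] ne s3 1 by auto
  next
    case 2
    have "{i \<in> I. 0 < a i} = {i, l, j}"
      unfolding P by blast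
    then show ?thesis
      using one[of i l j] ne s3 2 by auto
  next
    case 3
    then show ?thesis
      using one[OF P] ne s3 by auto
  next
    case 4
    consider "even (a i) \<longleftrightarrow> even (a j)" | "even (a i) \<longleftrightarrow> even (a l)" | "even (a j) \<longleftrightarrow> even (a l)"
      by blast
    then show ?thesis
      using flip I ne 4 by cases blast+
  qed
qed

lemma obtain_three:
  assumes "3 \<le> card S"
  obtains u v w where "u \<in> S" "v \<in> S" "w \<in> S" "u \<noteq> v" "u \<noteq> w" "v \<noteq> w"
proof -
  obtain T where T: "T \<subseteq> S" "card T = 3"
    using obtain_subset_with_card_n[OF assms] by blast
  then obtain u v w where "T = {u, v, w}" "u \<noteq> v" "u \<noteq> w" "v \<noteq> w"
    unfolding card_3_iff by blast
  then show thesis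
    using that[of u v w] T(1) by simp
qed

lemma splits_both_many_parts:
  assumes fin: "finite I" and m: "4 \<le> nparts I a" "nparts I a + 2 \<le> k" and sum: "sum a I = k + 2"
    and le: "\<And>i. i \<in> I \<Longrightarrow> a i \<le> k - 2" and i: "i \<in> I" "2 \<le> a i"
  shows "splits_both I k a"
proof -
  let ?P = "{i \<in> I. 0 < a i}"
  have iP: "i \<in> ?P"
    using i by auto
  have "3 \<le> card (?P - {i})"
    using m(1) fin iP unfolding nparts_def by simp
  then obtain u v w where uvw: "u \<in> ?P - {i}" "v \<in> ?P - {i}" "w \<in> ?P - {i}"
    and ne: "u \<noteq> v" "u \<noteq> w" "v \<noteq> w"
    by (rule obtain_three)
  have keep: "3 \<le> nparts I (drop_two a i)"
    using drop_two_stats(2)[where a = a, OF fin i] m(1) by (auto split: if_splits)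
  have flip: ?thesis
    if "x \<in> ?P" "y \<in> ?P" "x \<noteq> y" "even (a x) \<longleftrightarrow> even (a y)" "2 \<le> a x \<or> 2 \<le> a y \<or> 5 \<le> nparts I a"
    for x y
  proof (rule splits_both_keep_flip[OF fin sum m(2) i keep, of x y])
    show "3 \<le> nparts I (drop_pair a x y)"
      using drop_pair_stats(2)[OF fin, of x y a] that m(1) by (auto split: if_splits)
  qed (use that in auto)
  show ?thesis
  proof (cases "\<exists>x\<in>{u, v, w}. even (a x) \<longleftrightarrow> even (a i)")
    case True
    then obtain x where "x \<in> {u, v, w}" "even (a x) \<longleftrightarrow> even (a i)"
      by blast
    then show ?thesis
      using flip[of i x] uvw i by auto
  next
    case False
    then have par: "even (a u) \<longleftrightarrow> even (a v)" "even (a u) \<longleftrightarrow> even (a w)"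
      by auto
    show ?thesis
    proof (cases "2 \<le> a u \<or> 2 \<le> a v \<or> 2 \<le> a w \<or> 5 \<le> nparts I a")
      case True
      then show ?thesis
        using flip[of u v] flip[of u w] uvw ne par by auto
    next
      case small: False
      have "{i, u, v, w} \<subseteq> ?P" "card {i, u, v, w} = 4"
        using iP uvw ne by auto
      moreover have "card ?P = 4"
        using small m(1) unfolding nparts_def by simp
      ultimately have P: "?P = {i, u, v, w}"
        using card_subset_eq[of ?P "{i, u, v, w}"] fin by simp
      have "a u = 1" "a v = 1" "a w = 1"
        using small uvw by auto
      then have "a i + 3 = k + 2"
        using sum sum_eq_sum_parts[OF fin, of a] ne uvw unfolding P by auto
      then show ?thesis
        using le[OF i(1)] m by linarith
    qed
  qed
qed

lemma obtain_two_ones: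
  assumes "finite I" "sum a I + 2 \<le> 2 * nparts I a"
  obtains u v where "u \<in> I" "v \<in> I" "u \<noteq> v" "a u = 1" "a v = 1"
proof -
  have "2 \<le> card {i \<in> I. a i = 1}"
    using two_nparts_le[OF assms(1), of a] assms(2) by linarith
  then obtain T where T: "T \<subseteq> {i \<in> I. a i = 1}" "card T = 2"
    using obtain_subset_with_card_n by metis
  then obtain u v where "T = {u, v}" "u \<noteq> v"
    unfolding card_2_iff by blast
  then show thesis
    using that[of u v] T(1) by simp
qed

lemma obtain_one:
  assumes "finite I" "sum a I + 1 \<le> 2 * nparts I a"
  obtains u where "u \<in> I" "a u = 1"
proof -
  have "{i \<in> I. a i = 1} \<noteq> {}"
  proof
    assume "{i \<in> I. a i = 1} = {}"
    then show False
      using two_nparts_le[OF assms(1), of a] assms(2) by (simp only: card.empty)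
  qed
  then show thesis
    using that by blast
qed

text \<open>With \<open>k - 1\<close> parts, a blue type is reached by keeping all parts. For a red type, the number of
  parts has to fall to \<open>k - 2\<close> or \<open>k - 3\<close>.\<close>

lemma exists_not_red_type_pred_parts:
  assumes fin: "finite I" and m: "nparts I a = k - 1" and sum: "sum a I = k + 2" and k: "5 \<le> k"
  shows "\<exists>c\<le>a. sum c I = k \<and> \<not> red_type I c"
proof -
  obtain c where c: "c \<le> a" "sum c I + 2 = sum a I" "nparts I c = nparts I a"
    using drop_excess[OF fin, of a] m sum k by auto
  have "\<not> red_type I c"
    by (rule not_red_type_pred_parts) (use c m sum k in auto)
  then show ?thesis
    using c sum by (intro exI[of _ c]) simp
qed

lemma exists_red_type_pred_parts:
  assumes fin: "finite I" and m: "nparts I a = k - 1" and sum: "sum a I = k + 2"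
    and le: "\<And>i. i \<in> I \<Longrightarrow> a i \<le> k - 2" and k: "5 \<le> k"
  shows "\<exists>b\<le>a. sum b I = k \<and> red_type I b"
proof (cases "k = 5")
  case True
  \<comment> \<open>Here \<open>k - 3\<close> parts are too few for the parity argument. The type is \<open>(3, 2, 1, 1)\<close> or
    \<open>(2, 2, 2, 1)\<close>, and lowering its largest entry and an entry \<open>1\<close> gives \<open>(2, 2, 1)\<close>.\<close>
  have le3: "a x \<le> 3" if "x \<in> I" for x
    using le[OF that] True by simp
  have "\<exists>i\<in>I. 2 \<le> a i \<and> (\<forall>j\<in>I. j \<noteq> i \<longrightarrow> a j \<le> 2)"
  proof (cases "\<exists>i\<in>I. a i = 3")
    case True
    then obtain i where i: "i \<in> I" "a i = 3"
      by blast
    have "a j \<le> 2" if j: "j \<in> I" "j \<noteq> i" for j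
    proof (rule ccontr)
      assume "\<not> a j \<le> 2"
      then have aj: "a j = 3"
        using le3[OF j(1)] by simp
      \<comment> \<open>Two entries \<open>3\<close> would leave four parts with sum \<open>3\<close> after two removals.\<close>
      let ?b = "drop_two a i"
      have b: "sum ?b I = 5" "nparts I ?b = 4"
        using drop_two_stats[where a = a, OF fin i(1)] i(2) sum m \<open>k = 5\<close> by auto
      have bj: "?b j = 3"
        using aj j(2) by (simp add: drop_two_def)
      have "sum (drop_two ?b j) I = 3" "nparts I (drop_two ?b j) = 4"
        using drop_two_stats[where a = ?b, OF fin j(1)] bj b by auto
      then show False
        using nparts_le_sum[OF fin, of "drop_two ?b j"] by simp
    qed
    then show ?thesis
      using i by (intro bexI[of _ i]) auto
  next
    case no3: False
    have "\<exists>i\<in>I. 2 \<le> a i"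
    proof (rule ccontr)
      assume small: "\<not> ?thesis"
      have "sum a I \<le> (\<Sum>i\<in>I. min 1 (a i))"
      proof (rule sum_mono)
        show "a x \<le> min 1 (a x)" if "x \<in> I" for x
          using small that by (cases "a x \<le> 1") auto
      qed
      then show False
        using fin m sum True by (simp add: nparts_eq_sum)
    qed
    then obtain i where i: "i \<in> I" "2 \<le> a i"
      by blast
    have "a j \<le> 2" if "j \<in> I" for j
    proof -
      have "a j \<noteq> 3"
        using no3 that by blast
      then show ?thesis
        using le3[OF that] by linarith
    qed
    then show ?thesis
      using i by (intro bexI[of _ i]) auto
  qed
  then obtain i where i: "i \<in> I" "2 \<le> a i" "\<And>j. j \<in> I \<Longrightarrow> j \<noteq> i \<Longrightarrow> a j \<le> 2"
    by blast
  obtain u where u: "u \<in> I" "a u = 1"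
    using obtain_one[OF fin, of a] m sum k True by auto
  have iu: "i \<noteq> u"
    using i u by auto
  let ?b = "drop_pair a i u"
  have b: "sum ?b I = 5" "nparts I ?b = 3"
    using drop_pair_stats[where a = a, OF fin i(1) u(1) iu] i(2) u(2) sum m True by auto
  have b2: "?b x \<le> 2" if "x \<in> I" for x
    using le3[OF i(1)] i(3)[OF that] u(2) by (cases "x = i"; cases "x = u") (auto simp: drop_pair_def)
  have "sum ?b I + nodd I ?b = (\<Sum>x\<in>I. ?b x + ?b x mod 2)"
    using fin by (simp add: nodd_eq_sum sum.distrib)
  also have "\<dots> = (\<Sum>x\<in>I. 2 * min 1 (?b x))"
  proof (rule sum.cong[OF refl])
    have *: "n + n mod 2 = 2 * min 1 n" if "n \<le> 2" for n :: nat
    proof -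
      have "n \<in> {0, 1, 2}"
        using that by auto
      then show ?thesis
        by auto
    qed
    show "?b x + ?b x mod 2 = 2 * min 1 (?b x)" if "x \<in> I" for x
      using *[OF b2[OF that]] .
  qed
  also have "\<dots> = 2 * nparts I ?b"
    using fin by (simp add: nparts_eq_sum sum_distrib_left)
  finally have "nodd I ?b = 1"
    using b by simp
  then have "red_type I ?b"
    using red_type_middle[of I ?b] b by simp
  then show ?thesis
    using drop_pair_le[of a i u] b(1) True by (intro exI[of _ ?b]) simp
next
  case False
  \<comment> \<open>The sum \<open>k + 2\<close> and the number \<open>k - 1\<close> of parts differ in parity, so some part is even.\<close>
  have "\<exists>i\<in>I. 0 < a i \<and> even (a i)"
  proof (rule ccontr)
    assume "\<not> ?thesis"
    then have "{i \<in> I. odd (a i)} = {i \<in> I. 0 < a i}"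
      by (auto intro: odd_pos)
    then have "nodd I a = k - 1"
      using m unfolding nodd_def nparts_def by simp
    moreover have "even (k + 2 + nodd I a)"
      using nodd_parity[OF fin, of a] sum by simp
    ultimately show False
      using k by auto
  qed
  then obtain i where i: "i \<in> I" "0 < a i" "even (a i)"
    by blast
  obtain u v where uv: "u \<in> I" "v \<in> I" "u \<noteq> v" "a u = 1" "a v = 1"
  proof (rule obtain_two_ones[OF fin])
    show "sum a I + 2 \<le> 2 * nparts I a"
      using m sum k False by linarith
  qed
  have iu: "i \<noteq> u"
    using i uv by auto
  have ai: "a i \<noteq> 1"
    using i by auto
  let ?b = "drop_pair a i u" and ?c = "drop_pair a u v"
  have sb: "sum ?b I = k" "nparts I ?b + 2 = k" "nodd I ?b = nodd I a"
    using drop_pair_stats[where a = a, OF fin i(1) uv(1) iu i(2)] uv m sum k ai i(3)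
    by (auto simp: mod2_eq_if)
  have sc: "sum ?c I = k" "nparts I ?c + 3 = k" "nodd I ?c + 2 = nodd I a"
    using drop_pair_stats[where a = a, OF fin uv(1-3)] uv m sum k by auto
  have "splits_both I k a"
    by (rule splits_both_middle[OF drop_pair_le drop_pair_le sb(1) sc(1)])
      (use sb sc k False in auto)
  then show ?thesis
    unfolding splits_both_def by auto
qed

lemma splits_both_pred_parts:
  assumes "finite I" "nparts I a = k - 1" "sum a I = k + 2" "\<And>i. i \<in> I \<Longrightarrow> a i \<le> k - 2" "5 \<le> k"
  shows "splits_both I k a"
  using exists_red_type_pred_parts[OF assms] exists_not_red_type_pred_parts[OF assms(1-3,5)]
  unfolding splits_both_def by auto

text \<open>With at least \<open>k\<close> parts, the types \<open>(1, \<dots>, 1)\<close> and \<open>(2, 1, \<dots>, 1)\<close> are both reached.\<close>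

lemma splits_both_almost_all_ones:
  assumes fin: "finite I" and m: "k \<le> nparts I a" and sum: "sum a I = k + 2"
    and i: "i \<in> I" "2 \<le> a i" and k: "5 \<le> k"
  shows "splits_both I k a"
proof -
  have "nparts I a \<noteq> k + 2"
  proof
    assume eq: "nparts I a = k + 2"
    have "sum a (I - {i}) \<ge> (\<Sum>j\<in>I - {i}. min 1 (a j))"
      by (intro sum_mono) simp
    then show False
      using eq sum i fin by (simp add: nparts_eq_sum sum.remove[of I i])
  qed
  moreover have "nparts I a \<le> k + 2"
    using nparts_le_sum[OF fin, of a] sum by simp
  ultimately consider "nparts I a = k" | "nparts I a = k + 1"
    using m by linarith
  then show ?thesis
  proof cases
    case 1
    obtain b where b: "b \<le> a" "sum b I + 2 = sum a I" "nparts I b = nparts I a"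
      using drop_excess[OF fin, of a] 1 sum by auto
    have rb: "red_type I b"
      by (rule red_type_all_parts) (use b 1 sum k in auto)
    obtain u where u: "u \<in> I" "a u = 1"
      using obtain_one[OF fin, of a] 1 sum k by auto
    have iu: "i \<noteq> u"
      using i u by auto
    let ?c = "drop_pair a i u"
    have sc: "sum ?c I = k" "nparts I ?c + 1 = k"
      using drop_pair_stats[where a = a, OF fin i(1) u(1) iu] u i 1 sum by auto
    have rc: "\<not> red_type I ?c"
      by (rule not_red_type_pred_parts) (use sc k in auto)
    show ?thesis
      by (rule splits_bothI[OF b(1) drop_pair_le _ sc(1)]) (use b sum rb rc in auto)
  next
    case 2
    obtain u v where uv: "u \<in> I" "v \<in> I" "u \<noteq> v" "a u = 1" "a v = 1"
      using obtain_two_ones[OF fin, of a] 2 sum k by auto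
    let ?c = "drop_pair a u v" and ?b = "drop_two a i"
    have sc: "sum ?c I = k" "nparts I ?c + 1 = k"
      using drop_pair_stats[where a = a, OF fin uv(1-3)] uv 2 sum by auto
    have sb: "sum ?b I = k" "k \<le> nparts I ?b"
      using drop_two_stats[where a = a, OF fin i] 2 sum by (auto split: if_splits)
    have rb: "red_type I ?b"
      by (rule red_type_all_parts) (use sb nparts_le_sum[OF fin, of ?b] k in auto)
    have rc: "\<not> red_type I ?c"
      by (rule not_red_type_pred_parts) (use sc k in auto)
    show ?thesis
      by (rule splits_bothI[OF drop_two_le drop_pair_le sb(1) sc(1)]) (use rb rc in auto)
  qed
qed

lemma splits_both_of_le:
  assumes fin: "finite I" and sum: "sum a I = k + 2" and k: "5 \<le> k"
    and le: "\<And>i. i \<in> I \<Longrightarrow> a i \<le> k - 2" and i: "i \<in> I" "2 \<le> a i"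
  shows "splits_both I k a"
proof -
  have m1: "2 \<le> nparts I a"
  proof (rule ccontr)
    assume "\<not> ?thesis"
    then have "card {i \<in> I. 0 < a i} \<le> 1"
      unfolding nparts_def by simp
    moreover have "i \<in> {i \<in> I. 0 < a i}"
      using i by simp
    ultimately have P: "{i \<in> I. 0 < a i} = {i}"
      using fin by (intro equalityI subsetI) (auto simp: card_le_Suc0_iff_eq)
    then have "a i = k + 2"
      using sum sum_eq_sum_parts[OF fin, of a] unfolding P by simp
    then show False
      using le[OF i(1)] by simp
  qed
  consider "nparts I a = 2" | "nparts I a = 3" | "4 \<le> nparts I a" "nparts I a + 2 \<le> k"
    | "nparts I a = k - 1" | "k \<le> nparts I a"
    using m1 by linarith
  then show ?thesis
  proof cases
    case 1
    then show ?thesis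
      using splits_both_two_parts[OF fin _ sum le] k by simp
  next
    case 2
    then show ?thesis
      using splits_both_three_parts[OF fin _ sum le] k by simp
  next
    case 3
    then show ?thesis
      using splits_both_many_parts[OF fin _ _ sum le i] by simp
  next
    case 4
    then show ?thesis
      using splits_both_pred_parts[OF fin _ sum le] k by simp
  next
    case 5
    then show ?thesis
      using splits_both_almost_all_ones[OF fin _ sum i k] by simp
  qed
qed

section \<open>Types with one large entry\<close>

lemma sum_stats_remove:
  fixes a :: "'i \<Rightarrow> nat"
  assumes "finite I" "i \<in> I"
  shows "sum a I = a i + sum a (I - {i})"
    and "nparts I a = min 1 (a i) + nparts (I - {i}) a"
    and "nodd I a = a i mod 2 + nodd (I - {i}) a"
  using assms by (simp_all add: nparts_eq_sum nodd_eq_sum sum.remove[of I i])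

lemma red_type_pred_block:
  assumes fin: "finite I" and sum: "sum a I = k" and i: "i \<in> I" "a i = k - 1" and k: "2 \<le> k"
  shows "red_type I a"
proof -
  have rest: "sum a (I - {i}) = 1"
    using sum_stats_remove(1)[OF fin i(1), of a] sum i k by simp
  have "nparts (I - {i}) a \<le> 1"
    using nparts_le_sum[of "I - {i}" a] fin rest by simp
  then have "nparts I a \<le> 2"
    using sum_stats_remove(2)[OF fin i(1), of a] by simp
  moreover have "a j \<le> a i" if "j \<in> I" for j
  proof (cases "j = i")
    case False
    then have "a j \<le> sum a (I - {i})"
      using that fin by (intro member_le_sum) auto
    then show ?thesis
      using rest i k by simp
  qed simp
  ultimately have "red_type I a \<longleftrightarrow> odd (sum a I - a i)"
    using red_type_few_parts[OF _ i(1)] by blast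
  moreover have "sum a I - a i = 1"
    using sum i k by simp
  ultimately show ?thesis
    by simp
qed

text \<open>The type is \<open>(k - 2, 2)\<close> or \<open>(k - 2, 1, 1)\<close>; the latter has two or three odd entries.\<close>

lemma not_red_type_pred_pred_block:
  assumes fin: "finite I" and sum: "sum a I = k" and i: "i \<in> I" "a i = k - 2" and k: "5 \<le> k"
  shows "\<not> red_type I a"
proof -
  have rest: "sum a (I - {i}) = 2"
    using sum_stats_remove(1)[OF fin i(1), of a] sum i k by simp
  have m: "nparts (I - {i}) a \<le> 2"
    using nparts_le_sum[of "I - {i}" a] fin rest by simp
  have m': "nparts I a = 1 + nparts (I - {i}) a"
    using sum_stats_remove(2)[OF fin i(1), of a] i k by simp
  show ?thesis
  proof (cases "nparts I a \<le> 2")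
    case True
    have "a j \<le> a i" if "j \<in> I" for j
    proof (cases "j = i")
      case False
      then have "a j \<le> sum a (I - {i})"
        using that fin by (intro member_le_sum) auto
      then show ?thesis
        using rest i k by simp
    qed simp
    then have "red_type I a \<longleftrightarrow> odd (sum a I - a i)"
      using red_type_few_parts[OF True i(1)] by blast
    moreover have "sum a I - a i = 2"
      using sum i k by simp
    ultimately show ?thesis
      by simp
  next
    case False
    then have m2: "nparts (I - {i}) a = 2"
      using m m' by simp
    have "2 * nparts (I - {i}) a \<le> (\<Sum>x\<in>I - {i}. a x + a x mod 2)"
    proof -
      have "2 * min 1 n \<le> n + n mod 2" for n :: nat
        by (cases "n \<le> 1") (auto simp: min_def le_Suc_eq)
      then show ?thesis
        using fin by (simp add: nparts_eq_sum sum_distrib_left sum_mono)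
    qed
    then have "2 \<le> nodd (I - {i}) a"
      using fin rest m2 by (simp add: sum.distrib nodd_eq_sum)
    moreover have "nodd (I - {i}) a \<le> sum a (I - {i})"
      using fin by (simp add: nodd_eq_sum sum_mono)
    ultimately have "nodd I a = 2 \<or> nodd I a = 3"
      using sum_stats_remove(3)[OF fin i(1), of a] rest by (auto simp: mod2_eq_if)
    moreover have "red_type I a \<longleftrightarrow> nodd I a mod 4 < 2"
      by (rule red_type_middle) (use False m' m2 sum k in auto)
    ultimately show ?thesis
      by auto
  qed
qed

section \<open>Blowing up a colouring\<close>

text \<open>The type of \<open>X\<close> when the block of a point is given by \<open>b\<close>.\<close>

definition block_count :: "('a \<Rightarrow> 'i) \<Rightarrow> 'a set \<Rightarrow> 'i \<Rightarrow> nat"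
  where "block_count b X i = card {x \<in> X. b x = i}"

lemma sum_block_count:
  assumes "finite X" "finite I" "b ` X \<subseteq> I"
  shows "sum (block_count b X) I = card X"
  using sum.group[OF assms, of "\<lambda>_. 1::nat"] by (simp add: block_count_def)

lemma block_count_mono: "finite Y \<Longrightarrow> X \<subseteq> Y \<Longrightarrow> block_count b X i \<le> block_count b Y i"
  unfolding block_count_def by (intro card_mono) auto

lemma exists_subset_block_count:
  assumes fin: "finite Y" and a: "a \<le> block_count b Y"
  shows "\<exists>X\<subseteq>Y. block_count b X = a"
proof -
  have "\<exists>T. T \<subseteq> {x \<in> Y. b x = i} \<and> card T = a i" for i
  proof -
    have "a i \<le> card {x \<in> Y. b x = i}"
      using le_funD[OF a, of i] unfolding block_count_def .
    then show ?thesis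
      using obtain_subset_with_card_n by metis
  qed
  then obtain T where T: "\<And>i. T i \<subseteq> {x \<in> Y. b x = i}" "\<And>i. card (T i) = a i"
    by metis
  have "{x \<in> \<Union> (range T). b x = i} = T i" for i
    using T(1) by blast
  then have "block_count b (\<Union> (range T)) = a"
    using T(2) by (simp add: block_count_def fun_eq_iff)
  moreover have "\<Union> (range T) \<subseteq> Y"
    using T(1) by blast
  ultimately show ?thesis
    by blast
qed

lemma exists_subset_one_block_count:
  assumes fin: "finite H" and n: "1 \<le> n" "n < k" "n \<le> block_count b H i"
    and out: "k + block_count b H i \<le> card H + n"
  shows "\<exists>X\<subseteq>H. card X = k \<and> block_count b X i = n \<and> card (b ` X) \<noteq> 1"
proof -
  let ?B = "{x \<in> H. b x = i}"
  have "k - n \<le> card (H - ?B)"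
    using out card_Diff_subset[of ?B H] fin n unfolding block_count_def by auto
  then obtain C where C: "C \<subseteq> H - ?B" "card C = k - n" "finite C"
    by (rule obtain_subset_with_card_n)
  have "n \<le> card ?B"
    using n unfolding block_count_def by simp
  then obtain A where A: "A \<subseteq> ?B" "card A = n" "finite A"
    by (rule obtain_subset_with_card_n)
  have "{x \<in> A \<union> C. b x = i} = A"
    using A C by blast
  then have "block_count b (A \<union> C) i = n"
    using A by (simp add: block_count_def)
  moreover have "A \<inter> C = {}"
    using A(1) C(1) by blast
  then have "card (A \<union> C) = k"
    using A C n by (simp add: card_Un_disjoint)
  moreover have "card (b ` (A \<union> C)) \<noteq> 1"
  proof
    assume "card (b ` (A \<union> C)) = 1"
    then obtain j where j: "b ` (A \<union> C) = {j}"
      by (rule card_1_singletonE)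
    have "A \<noteq> {}" "C \<noteq> {}"
      using A C n by auto
    then obtain x y where xy: "x \<in> A" "y \<in> C"
      by blast
    then have "b x = j" "b y = j"
      using j by blast+
    moreover have "b x = i" "b y \<noteq> i"
      using xy A(1) C(1) by blast+
    ultimately show False
      by simp
  qed
  moreover have "A \<union> C \<subseteq> H"
    using A C by blast
  ultimately show ?thesis
    by blast
qed

lemma red_type_at_most_one:
  assumes fin: "finite I" and k: "3 \<le> sum a I" and le: "\<And>i. i \<in> I \<Longrightarrow> a i \<le> 1"
  shows "red_type I a"
proof -
  have "nparts I a = sum a I"
    using fin le by (simp add: nparts_eq_sum min_absorb2)
  then show ?thesis
    using red_type_all_parts[of I a] k by simp
qed

text \<open>The block of a point of \<open>V\<close> is given by \<open>b\<close>, its position in the block by \<open>c\<close>. There are fewer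
  than \<open>p\<close> blocks, and each is a copy of a subset of \<open>U\<close>.\<close>

lemma not_partn_lst_blow_up:
  assumes fin: "finite I" and I: "card I < p" "b ` V \<subseteq> I" and U: "c ` V \<subseteq> U"
    and inj: "\<And>i. inj_on c {x \<in> V. b x = i}"
    and k: "5 \<le> k" and p: "k + 2 \<le> p" and q: "k + 2 \<le> q"
    and not_partn: "\<not> partn_lst U [p - 1, q] k"
  shows "\<not> partn_lst V [p, q] k"
proof
  assume partn: "partn_lst V [p, q] k"
  obtain f where f: "f \<in> nsets U k \<rightarrow> {..<2}"
    and no: "\<And>\<xi>. \<xi> < 2 \<Longrightarrow> \<not> monochromatic U ([p - 1, q] ! \<xi>) k f \<xi>"
    using not_partn unfolding partn_lst_def by (auto simp: numeral_2_eq_2)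
  \<comment> \<open>Colour \<open>0\<close> is red and colour \<open>1\<close> is blue; \<open>card (b ` X) = 1\<close> says that \<open>X\<close> lies in one block.\<close>
  define F where "F X = (if card (b ` X) = 1 then f (c ` X)
    else if red_type I (block_count b X) then 0 else 1)" for X
  have inj_block: "inj_on c W" if "W \<subseteq> V" "b ` W \<subseteq> {i}" for W i
    using inj_on_subset[OF inj[of i]] that by blast
  have image_nsets: "c ` W \<in> nsets U w" if "W \<subseteq> V" "b ` W \<subseteq> {i}" "finite W" "card W = w" for W i w
  proof -
    have "c ` W \<subseteq> U"
      using that(1) U by blast
    then show ?thesis
      using that(3,4) card_image[OF inj_block[OF that(1,2)]] by (simp add: nsets_def)
  qed
  have "F \<in> nsets V k \<rightarrow> {..<length [p, q]}"
  proof
    fix X assume X: "X \<in> nsets V k"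
    show "F X \<in> {..<length [p, q]}"
    proof (cases "card (b ` X) = 1")
      case True
      then obtain i where "b ` X = {i}"
        by (rule card_1_singletonE)
      then have "c ` X \<in> nsets U k"
        using image_nsets[of X i k] X by (simp add: nsets_def)
      then have "f (c ` X) \<in> {..<2}"
        using f by blast
      then show ?thesis
        using True by (simp add: F_def)
    qed (simp add: F_def)
  qed
  then obtain \<xi> H where \<xi>: "\<xi> < 2" and H: "H \<in> nsets V ([p, q] ! \<xi>)"
    and mono: "F ` nsets H k \<subseteq> {\<xi>}"
    using partn unfolding partn_lst_def monochromatic_def by (auto simp: numeral_2_eq_2)
  have HV: "H \<subseteq> V" and finH: "finite H" and cardH: "card H = [p, q] ! \<xi>"
    using H by (auto simp: nsets_def)
  have cardH_ge: "k + 2 \<le> card H"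
    using cardH p q \<xi> by (auto simp: less_2_cases_iff)
  have FX: "F X = \<xi>" if "X \<subseteq> H" "card X = k" for X
    using mono that finite_subset[OF that(1) finH] by (auto simp: nsets_def)
  have one_block: False if W: "W \<subseteq> H" "b ` W \<subseteq> {i}" "card W = [p - 1, q] ! \<xi>" for W i
  proof -
    have WV: "W \<subseteq> V" and finW: "finite W"
      using W(1) HV finite_subset[OF W(1) finH] by auto
    have "f Y = \<xi>" if Y: "Y \<in> nsets (c ` W) k" for Y
    proof -
      obtain X where X: "X \<subseteq> W" "Y = c ` X"
        using Y by (auto simp: nsets_def subset_image_iff)
      have "card X = k"
        using Y card_image[OF inj_on_subset[OF inj_block[OF WV W(2)] X(1)]] X(2)
        by (simp add: nsets_def)
      moreover have "b ` X = {i}"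
      proof -
        have "X \<noteq> {}"
          using \<open>card X = k\<close> k by auto
        then show ?thesis
          using X(1) W(2) by blast
      qed
      ultimately show ?thesis
        using FX[of X] X W(1) by (simp add: F_def)
    qed
    then have "f ` nsets (c ` W) k \<subseteq> {\<xi>}"
      by blast
    then have "monochromatic U ([p - 1, q] ! \<xi>) k f \<xi>"
      unfolding monochromatic_def using image_nsets[OF WV W(2) finW W(3)] by blast
    then show False
      using no[OF \<xi>] by contradiction
  qed
  have colour: "red_type I (block_count b X) \<longleftrightarrow> \<xi> = 0"
    if "X \<subseteq> H" "card X = k" "card (b ` X) \<noteq> 1" for X
    using FX[OF that(1,2)] that(3) by (auto simp: F_def split: if_splits)
  have sumX: "sum (block_count b X) I = card X" if "X \<subseteq> H" for X
    using sum_block_count[OF finite_subset[OF that finH] fin] that HV I(2) by blast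
  have card_block: "block_count b H i \<le> card H" for i
    unfolding block_count_def by (rule card_mono[OF finH]) auto
  \<comment> \<open>A monochromatic set that meets a block twice meets some block in at least \<open>k - 1\<close> points.\<close>
  have spread: "\<exists>i\<in>I. k - 1 \<le> block_count b H i" if i2: "i \<in> I" "2 \<le> block_count b H i" for i
  proof (rule ccontr)
    assume "\<not> ?thesis"
    then have small: "block_count b H j \<le> k - 2" if "j \<in> I" for j
      using that by fastforce
    obtain T where T: "T \<subseteq> {x \<in> H. b x = i}" "card T = 2"
      using obtain_subset_with_card_n i2(2) unfolding block_count_def by metis
    obtain Z where Z: "T \<subseteq> Z" "Z \<subseteq> H" "card Z = k + 2"
      using exists_subset_between[of T "k + 2" H] T cardH_ge finH k by auto
    have finZ: "finite Z"
      using finite_subset[OF Z(2) finH] .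
    have smallZ: "block_count b Z j \<le> k - 2" if "j \<in> I" for j
      by (rule le_trans[OF block_count_mono[OF finH Z(2)] small[OF that]])
    have "2 \<le> block_count b Z i"
    proof -
      have "T \<subseteq> {x \<in> Z. b x = i}"
        using T(1) Z(1) by blast
      then show ?thesis
        using card_mono[of "{x \<in> Z. b x = i}" T] finZ T(2) by (simp add: block_count_def)
    qed
    then have "splits_both I k (block_count b Z)"
      using splits_both_of_le[OF fin _ k smallZ i2(1)] sumX[OF Z(2)] Z(3) by simp
    then obtain r s where r: "r \<le> block_count b Z" "sum r I = k" "red_type I r"
      and s: "s \<le> block_count b Z" "sum s I = k" "\<not> red_type I s"
      unfolding splits_both_def by auto
    have realised: "red_type I t \<longleftrightarrow> \<xi> = 0" if t: "t \<le> block_count b Z" "sum t I = k" for t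
    proof -
      obtain X where X: "X \<subseteq> Z" "block_count b X = t"
        using exists_subset_block_count[OF finZ t(1)] by blast
      have XH: "X \<subseteq> H"
        using X(1) Z(2) by blast
      have cardX: "card X = k"
        using sumX[OF XH] X(2) t(2) by simp
      have "card (b ` X) \<noteq> 1"
      proof
        assume "card (b ` X) = 1"
        then obtain j where j: "b ` X = {j}"
          by (rule card_1_singletonE)
        then have "j \<in> I"
          using XH HV I(2) by blast
        have "{x \<in> X. b x = j} = X"
          using j by blast
        then have "k = block_count b X j"
          using cardX by (simp add: block_count_def)
        also have "\<dots> \<le> k - 2"
          using X(2) le_funD[OF t(1), of j] smallZ[OF \<open>j \<in> I\<close>] by simp
        finally show False
          using k by simp
      qed
      then show ?thesis
        using colour[OF XH cardX] X(2) by simp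
    qed
    show False
      using realised[OF r(1,2)] realised[OF s(1,2)] r(3) s(3) by blast
  qed
  \<comment> \<open>The next two facts use edges of type \<open>(k - 1, 1)\<close>, and of type \<open>(k - 2, 2)\<close> or
    \<open>(k - 2, 1, 1)\<close>.\<close>
  have large_block_red: "\<xi> = 0" if i: "i \<in> I" "k - 1 \<le> block_count b H i" "block_count b H i < card H" for i
  proof -
    have "\<exists>X\<subseteq>H. card X = k \<and> block_count b X i = k - 1 \<and> card (b ` X) \<noteq> 1"
      by (rule exists_subset_one_block_count[OF finH]) (use i k in linarith)+
    then obtain X where X: "X \<subseteq> H" "card X = k" "block_count b X i = k - 1" "card (b ` X) \<noteq> 1"
      by blast
    have "red_type I (block_count b X)"
      using red_type_pred_block[OF fin _ i(1)] sumX[OF X(1)] X k by simp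
    then show ?thesis
      using colour[OF X(1,2,4)] by simp
  qed
  have large_block_blue: "\<xi> \<noteq> 0"
    if i: "i \<in> I" "k - 1 \<le> block_count b H i" "block_count b H i + 2 \<le> card H" for i
  proof -
    have "\<exists>X\<subseteq>H. card X = k \<and> block_count b X i = k - 2 \<and> card (b ` X) \<noteq> 1"
      by (rule exists_subset_one_block_count[OF finH]) (use i k in linarith)+
    then obtain X where X: "X \<subseteq> H" "card X = k" "block_count b X i = k - 2" "card (b ` X) \<noteq> 1"
      by blast
    have "\<not> red_type I (block_count b X)"
      using not_red_type_pred_pred_block[OF fin _ i(1)] sumX[OF X(1)] X k by simp
    then show ?thesis
      using colour[OF X(1,2,4)] by simp
  qed
  consider "\<xi> = 0" | "\<xi> = 1"
    using \<xi> by linarith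
  then show False
  proof cases
    case 1
    have "\<exists>i\<in>I. 2 \<le> block_count b H i"
    proof (rule ccontr)
      assume no2: "\<not> ?thesis"
      have "sum (block_count b H) I \<le> (\<Sum>i\<in>I. 1)"
      proof (rule sum_mono)
        show "block_count b H i \<le> 1" if "i \<in> I" for i
        proof -
          have "\<not> 2 \<le> block_count b H i"
            using no2 that by blast
          then show ?thesis
            by linarith
        qed
      qed
      then show False
        using sumX[of H] cardH 1 I(1) by simp
    qed
    then obtain i where i: "i \<in> I" "k - 1 \<le> block_count b H i"
      using spread by blast
    have "p - 1 \<le> block_count b H i"
    proof (rule ccontr)
      assume "\<not> ?thesis"
      then have "block_count b H i + 2 \<le> card H"
        using cardH 1 p by simp
      then show False
        using large_block_blue[OF i] 1 by simp
    qed
    then obtain W where "W \<subseteq> {x \<in> H. b x = i}" "card W = p - 1"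
      unfolding block_count_def using obtain_subset_with_card_n by metis
    then show False
      using one_block[of W i] 1 by auto
  next
    case 2
    have "\<exists>i\<in>I. 2 \<le> block_count b H i"
    proof (rule ccontr)
      assume "\<not> ?thesis"
      then have le1: "block_count b H i \<le> 1" if "i \<in> I" for i
        using that by fastforce
      obtain X where X: "X \<subseteq> H" "card X = k"
        using obtain_subset_with_card_n[of k H] cardH_ge by auto
      have X1: "block_count b X i \<le> 1" if "i \<in> I" for i
        by (rule le_trans[OF block_count_mono[OF finH X(1)] le1[OF that]])
      have "card (b ` X) \<noteq> 1"
      proof
        assume "card (b ` X) = 1"
        then obtain j where j: "b ` X = {j}"
          by (rule card_1_singletonE)
        then have "j \<in> I"
          using X(1) HV I(2) by blast
        have "{x \<in> X. b x = j} = X"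
          using j by blast
        then have "k = block_count b X j"
          using X(2) by (simp add: block_count_def)
        then show False
          using X1[OF \<open>j \<in> I\<close>] k by simp
      qed
      moreover have "red_type I (block_count b X)"
        by (rule red_type_at_most_one[OF fin]) (use sumX[OF X(1)] X k X1 in auto)
      ultimately show False
        using colour[OF X] 2 by simp
    qed
    then obtain i where i: "i \<in> I" "k - 1 \<le> block_count b H i"
      using spread by blast
    have "block_count b H i = card H"
      using large_block_red[OF i] 2 card_block[of i] by (cases "block_count b H i < card H") simp_all
    then have "{x \<in> H. b x = i} = H"
      unfolding block_count_def by (intro card_subset_eq[OF finH]) auto
    then show False
      using one_block[of H i] 2 cardH by auto
  qed
qed

section \<open>The lower bound for Ramsey numbers\<close>

lemma partn_lst_mono:
  assumes "partn_lst A \<alpha> k" "A \<subseteq> B"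
  shows "partn_lst B \<alpha> k"
  unfolding partn_lst_def
proof
  fix f assume "f \<in> nsets B k \<rightarrow> {..<length \<alpha>}"
  then have "f \<in> nsets A k \<rightarrow> {..<length \<alpha>}"
    using nsets_mono[OF assms(2)] by blast
  then obtain i where "i < length \<alpha>" "monochromatic A (\<alpha> ! i) k f i"
    using assms(1) unfolding partn_lst_def by blast
  then show "\<exists>i<length \<alpha>. monochromatic B (\<alpha> ! i) k f i"
    using nsets_mono[OF assms(2)] unfolding monochromatic_def by blast
qed

lemma less_ramsey_number:
  assumes "\<not> partn_lst {1..n} [p, q] k"
  shows "n < ramsey_number k p q"
proof (rule ccontr)
  assume "\<not> ?thesis"
  then have "{1..ramsey_number k p q} \<subseteq> {1..n}"
    by simp
  then show False
    using partn_lst_mono[OF partn_lst_ramsey_number] assms by blast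
qed

lemma ramsey_number_lower_bound:
  assumes k: "5 \<le> k" and p: "k + 2 \<le> p" and q: "k + 2 \<le> q"
    and r: "ramsey_number k (p - 1) q = Suc n"
  shows "(p - 1) * n < ramsey_number k p q"
proof (rule less_ramsey_number)
  have "\<not> partn_lst {1..n} [p - 1, q] k"
    using r not_less_Least[of n "\<lambda>N. partn_lst {1..N} [p - 1, q] k"] by (simp add: ramsey_number_def)
  then show "\<not> partn_lst {1..(p - 1) * n} [p, q] k"
  proof (rule not_partn_lst_blow_up[rotated -1])
    show "(\<lambda>x. (x - 1) div n) ` {1..(p - 1) * n} \<subseteq> {..<p - 1}"
      by (auto intro!: less_mult_imp_div_less)
    show "(\<lambda>x. (x - 1) mod n + 1) ` {1..(p - 1) * n} \<subseteq> {1..n}"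
    proof -
      have "(x - 1) mod n + 1 \<le> n" if "x \<in> {1..(p - 1) * n}" for x
      proof -
        have "0 < n"
          using that by (cases n) auto
        then show ?thesis
          using mod_less_divisor[of n "x - 1"] by linarith
      qed
      then show ?thesis
        by auto
    qed
    show "inj_on (\<lambda>x. (x - 1) mod n + 1) {x \<in> {1..(p - 1) * n}. (x - 1) div n = i}" for i
    proof (rule inj_onI)
      fix x y
      assume x: "x \<in> {x \<in> {1..(p - 1) * n}. (x - 1) div n = i}"
        and y: "y \<in> {x \<in> {1..(p - 1) * n}. (x - 1) div n = i}"
        and eq: "(x - 1) mod n + 1 = (y - 1) mod n + 1"
      have "(x - 1) div n = (y - 1) div n" "(x - 1) mod n = (y - 1) mod n"
        using x y eq by simp_all
      then have "x - 1 = y - 1"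
        by (metis div_mult_mod_eq)
      then show "x = y"
        using x y by auto
    qed
  qed (use k p q in auto)
qed

theorem theorem2:
  shows "\<exists>c::nat. c \<ge> 25 \<and>
    (\<forall>k p q :: nat. 5 \<le> k \<and> k \<le> c \<and> p \<ge> k + 2 \<and> q \<ge> k + 2 \<longrightarrow>
      int (ramsey_number k p q) \<ge> (int p - 1) * (int (ramsey_number k (p - 1) q) - 1) + 1)"
  \<comment> \<open>The inequality holds for all \<open>k \<ge> 5\<close>, so every \<open>c \<ge> 25\<close> is a witness.\<close>
proof (intro exI[of _ 25] conjI allI impI)
  fix k p q :: nat
  assume kpq: "5 \<le> k \<and> k \<le> 25 \<and> p \<ge> k + 2 \<and> q \<ge> k + 2"
  have p1: "int (p - 1) = int p - 1"
    using kpq by simp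
  show "int (ramsey_number k p q) \<ge> (int p - 1) * (int (ramsey_number k (p - 1) q) - 1) + 1"
  proof (cases "ramsey_number k (p - 1) q")
    case 0
    \<comment> \<open>The right-hand side is then \<open>2 - p\<close>, which is negative.\<close>
    then show ?thesis
      using kpq by simp
  next
    case (Suc n)
    have "(p - 1) * n < ramsey_number k p q"
      using ramsey_number_lower_bound[OF _ _ _ Suc] kpq by simp
    then have "int ((p - 1) * n) + 1 \<le> int (ramsey_number k p q)"
      by linarith
    then show ?thesis
      using Suc p1 by simp
  qed
qed simp

end
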